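(* Let $(W,S)$ be a right-angled Coxeter system. For every integer $n\ge 0$ there is some $d(n)\in\mathbb{N}$, depending only on $n$ (for the given $(W,S)$), such that $F^{\#}(\overline{w})>n$ for all $\overline{w}\in W$ with $l(\overline{w})>d(n)$.
   Context: A Coxeter system $(W,S)$ has finite generating set $S$; it is right-angled if all entries of its Coxeter matrix are $1$, $2$ or $\infty$. $l$ denotes the word length on $W$ with respect to $S$. An element $\overline{w}\in W$ is called firm if every reduced word representing $\overline w$ ends with the same letter; equivalently, there is a unique $r\in S$ such that $l(\overline{w}r)<l(\overline{w})$. The firmness $F^{\#}(\overline{w})$ is the largest $k$ such that $\overline{w}$ can be represented by a reduced word of the form $s_1\cdots s_k t_{k+1}\cdots t_\ell$ with $s_1\cdots s_k$ firm (the identity has firmness $0$). *)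

theory Defs
  imports "HOL-Algebra.Algebra" "HOL-Library.Extended_Nat"
begin

section \<open>Group presentations\<close>

text \<open>A letter \<open>(s, True)\<close> stands for the generator \<open>s\<close>, and \<open>(s, False)\<close> for its formal inverse.\<close>

type_synonym 'a signed_word = "('a \<times> bool) list"

definition eval_signed :: "('a, 'b) monoid_scheme \<Rightarrow> 'a signed_word \<Rightarrow> 'a" where
  "eval_signed G ws =
     foldr (\<lambda>(s, b) x. (if b then s else inv\<^bsub>G\<^esub> s) \<otimes>\<^bsub>G\<^esub> x) ws \<one>\<^bsub>G\<^esub>"

text \<open>Two signed words over \<open>S\<close> are related iff they denote the same element of the group
  \<open>\<langle>S | R\<rangle>\<close>, i.e. of the free group on \<open>S\<close> modulo the normal closure of \<open>R\<close>.\<close>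

inductive pres_eq :: "'a set \<Rightarrow> 'a signed_word set \<Rightarrow> 'a signed_word \<Rightarrow> 'a signed_word \<Rightarrow> bool"
  for S :: "'a set" and R :: "'a signed_word set" where
  refl: "u \<in> lists (S \<times> UNIV) \<Longrightarrow> pres_eq S R u u"
| sym: "pres_eq S R u v \<Longrightarrow> pres_eq S R v u"
| trans: "pres_eq S R u v \<Longrightarrow> pres_eq S R v w \<Longrightarrow> pres_eq S R u w"
| cancel: "u \<in> lists (S \<times> UNIV) \<Longrightarrow> v \<in> lists (S \<times> UNIV) \<Longrightarrow> s \<in> S \<Longrightarrow>
    pres_eq S R (u @ [(s, b), (s, \<not> b)] @ v) (u @ v)"
| relator: "u \<in> lists (S \<times> UNIV) \<Longrightarrow> v \<in> lists (S \<times> UNIV) \<Longrightarrow>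
    r \<in> R \<Longrightarrow> r \<in> lists (S \<times> UNIV) \<Longrightarrow> pres_eq S R (u @ r @ v) (u @ v)"

definition has_presentation ::
    "('a, 'b) monoid_scheme \<Rightarrow> 'a set \<Rightarrow> 'a signed_word set \<Rightarrow> bool" where
  "has_presentation G S R \<longleftrightarrow>
     group G \<and> S \<subseteq> carrier G \<and> generate G S = carrier G \<and>
     (\<forall>u \<in> lists (S \<times> UNIV). \<forall>v \<in> lists (S \<times> UNIV).
        eval_signed G u = eval_signed G v \<longleftrightarrow> pres_eq S R u v)"

section \<open>Coxeter systems\<close>

definition coxeter_matrix :: "'a set \<Rightarrow> ('a \<Rightarrow> 'a \<Rightarrow> enat) \<Rightarrow> bool" where
  "coxeter_matrix S m \<longleftrightarrow>
     (\<forall>s\<in>S. m s s = 1) \<and>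
     (\<forall>s\<in>S. \<forall>t\<in>S. m s t = m t s) \<and>
     (\<forall>s\<in>S. \<forall>t\<in>S. s \<noteq> t \<longrightarrow> m s t \<ge> 2)"

text \<open>The relators \<open>(s t)\<^bsup>m s t\<^esup>\<close>; an entry \<open>\<infinity>\<close> contributes none.\<close>

definition coxeter_relators :: "'a set \<Rightarrow> ('a \<Rightarrow> 'a \<Rightarrow> enat) \<Rightarrow> 'a signed_word set" where
  "coxeter_relators S m =
     {concat (replicate k [(s, True), (t, True)]) | s t k. s \<in> S \<and> t \<in> S \<and> m s t = enat k}"

locale coxeter_system =
  fixes W :: "('a, 'b) monoid_scheme" (structure) and S :: "'a set" and m :: "'a \<Rightarrow> 'a \<Rightarrow> enat"
  assumes finite_generators: "finite S"
    and coxeter_matrix: "coxeter_matrix S m"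
    and presentation: "has_presentation W S (coxeter_relators S m)"

locale right_angled_coxeter_system = coxeter_system +
  assumes right_angled: "\<And>s t. s \<in> S \<Longrightarrow> t \<in> S \<Longrightarrow> m s t \<in> {1, 2, \<infinity>}"

section \<open>Reduced words and firmness\<close>

definition eval_word :: "('a, 'b) monoid_scheme \<Rightarrow> 'a list \<Rightarrow> 'a" where
  "eval_word W ws = foldr (\<otimes>\<^bsub>W\<^esub>) ws \<one>\<^bsub>W\<^esub>"

definition word_length :: "('a, 'b) monoid_scheme \<Rightarrow> 'a set \<Rightarrow> 'a \<Rightarrow> nat" where
  "word_length W S w = (LEAST n. \<exists>ws \<in> lists S. eval_word W ws = w \<and> length ws = n)"

definition reduced_word_for :: "('a, 'b) monoid_scheme \<Rightarrow> 'a set \<Rightarrow> 'a list \<Rightarrow> 'a \<Rightarrow> bool" where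
  "reduced_word_for W S ws w \<longleftrightarrow>
     ws \<in> lists S \<and> eval_word W ws = w \<and> length ws = word_length W S w"

text \<open>The identity, whose only reduced word is empty, is not firm.\<close>

definition firm :: "('a, 'b) monoid_scheme \<Rightarrow> 'a set \<Rightarrow> 'a \<Rightarrow> bool" where
  "firm W S w \<longleftrightarrow>
     (\<exists>r\<in>S. \<forall>ws. reduced_word_for W S ws w \<longrightarrow> ws \<noteq> [] \<and> last ws = r)"

text \<open>For \<open>w \<noteq> \<one>\<close> the set below is nonempty (the first letter of a reduced word is firm) and
  bounded by the length of \<open>w\<close>.\<close>

definition firmness :: "('a, 'b) monoid_scheme \<Rightarrow> 'a set \<Rightarrow> 'a \<Rightarrow> nat" where
  "firmness W S w =
     (if w = \<one>\<^bsub>W\<^esub> then 0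
      else Max {k. \<exists>ss ts. reduced_word_for W S (ss @ ts) w \<and> length ss = k \<and>
                           firm W S (eval_word W ss)})"

end

theory Submission
  imports Defs
begin

text \<open>
  In a right-angled Coxeter group, all reduced words of an element contain each generator equally
  often (\<open>reduced_words_same_count\<close>). Granted this, one may take \<open>d(n) = n \<cdot> |S|\<close>. A reduced word
  longer than that contains some generator \<open>s\<close> at least \<open>n + 1\<close> times. Among all prefixes of
  reduced words of \<open>w\<close> that still contain \<open>s\<close> more than \<open>n\<close> times, let \<open>ss\<close> be a shortest one. Any
  other reduced word \<open>ss'\<close> of the element of \<open>ss\<close> can replace \<open>ss\<close> in the word of \<open>w\<close>, and contains
  \<open>s\<close> as often. So \<open>ss'\<close> ends with \<open>s\<close>, since otherwise removing its last letter would give a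
  shorter prefix of the same kind. Hence \<open>ss\<close> is firm, and its length exceeds \<open>n\<close>.

  The invariance of the letter counts comes from the classical cocycle on reflections. To the word
  \<open>s\<^sub>1 \<dots> s\<^sub>k\<close> belong the reflections \<open>t\<^sub>i = s\<^sub>1 \<dots> s\<^sub>i \<dots> s\<^sub>1\<close>; call \<open>s\<^sub>i\<close> the type of the \<open>i\<close>-th one.
  The parity of the number of \<open>i\<close> with \<open>t\<^sub>i = x\<close> and \<open>s\<^sub>i = r\<close> depends only on the group element
  represented, because the defining relators \<open>s s\<close> and \<open>s t s t\<close> contribute every pair of a
  reflection and a type an even number of times. This is where right-angledness enters: for
  \<open>m s t = 3\<close> the relator yields the reflection \<open>s t s\<close> once with type \<open>t\<close> and once with type \<open>s\<close>.
  In a reduced word the \<open>t\<^sub>i\<close> are distinct, so the number of letters \<open>s\<close> is the number of reflections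
  that occur with odd parity and type \<open>s\<close>, and this depends on the element alone.
\<close>

section \<open>Words and lengths in a right-angled Coxeter group\<close>

text \<open>The recursion strips the first letter \<open>s\<close>: the remaining reflections of the word are the
  conjugates by \<open>s\<close> of those of the tail, and conjugation by \<open>s\<close> is an involution, so \<open>x\<close> occurs
  among them iff \<open>s x s\<close> occurs for the tail. The Boolean inequality is addition modulo 2.\<close>

fun odd_reflection :: "('a, 'b) monoid_scheme \<Rightarrow> 'a list \<Rightarrow> 'a \<Rightarrow> 'a \<Rightarrow> bool" where
  "odd_reflection G [] x r = False"
| "odd_reflection G (s # ws) x r =
     ((x = s \<and> r = s) \<noteq> odd_reflection G ws (s \<otimes>\<^bsub>G\<^esub> x \<otimes>\<^bsub>G\<^esub> s) r)"

lemma eval_word_simps [simp]: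
  "eval_word G [] = \<one>\<^bsub>G\<^esub>"
  "eval_word G (s # ws) = s \<otimes>\<^bsub>G\<^esub> eval_word G ws"
  by (simp_all add: eval_word_def)

lemma eval_signed_positive: "eval_signed G (map (\<lambda>s. (s, True)) ws) = eval_word G ws"
  by (induction ws) (simp_all add: eval_signed_def)

context right_angled_coxeter_system
begin

lemma group_W: "group W"
  and S_subset_carrier: "S \<subseteq> carrier W"
  and generate_S: "generate W S = carrier W"
  and eval_eq_iff_pres_eq: "u \<in> lists (S \<times> UNIV) \<Longrightarrow> v \<in> lists (S \<times> UNIV) \<Longrightarrow>
    eval_signed W u = eval_signed W v \<longleftrightarrow> pres_eq S (coxeter_relators S m) u v"
  using presentation by (auto simp: has_presentation_def)

sublocale group W
  by (rule group_W)

lemma generator_closed [simp]: "s \<in> S \<Longrightarrow> s \<in> carrier W"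
  using S_subset_carrier by blast

lemma relator_trivial:
  assumes "r \<in> coxeter_relators S m" "r \<in> lists (S \<times> UNIV)"
  shows "eval_signed W r = \<one>"
proof -
  have "pres_eq S (coxeter_relators S m) ([] @ r @ []) ([] @ [])"
    using assms by (intro pres_eq.relator) auto
  then have "eval_signed W r = eval_signed W []"
    using eval_eq_iff_pres_eq[of r "[]"] assms by simp
  then show ?thesis by (simp add: eval_signed_def)
qed

lemma generator_square [simp]:
  assumes "s \<in> S"
  shows "s \<otimes> s = \<one>"
proof -
  have "m s s = enat 1"
    using coxeter_matrix assms by (simp add: coxeter_matrix_def one_enat_def)
  then have "concat (replicate 1 [(s, True), (s, True)]) \<in> coxeter_relators S m"
    unfolding coxeter_relators_def using assms by blast
  from relator_trivial[OF this] show ?thesis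
    using assms by (simp add: eval_signed_def)
qed

lemma generator_cancel [simp]:
  assumes "s \<in> S" "x \<in> carrier W"
  shows "s \<otimes> (s \<otimes> x) = x" "x \<otimes> s \<otimes> s = x"
  using assms generator_square[of s] by (simp_all add: m_assoc[symmetric]) (simp add: m_assoc)

lemma generator_conj_eq_iff:
  assumes "s \<in> S" "x \<in> carrier W" "y \<in> carrier W"
  shows "s \<otimes> x \<otimes> s = y \<longleftrightarrow> x = s \<otimes> y \<otimes> s"
proof
  assume "s \<otimes> x \<otimes> s = y"
  then have "s \<otimes> y \<otimes> s = s \<otimes> (s \<otimes> (x \<otimes> s \<otimes> s))"
    using assms by (auto simp: m_assoc)
  then show "x = s \<otimes> y \<otimes> s" using assms by simp
next
  assume "x = s \<otimes> y \<otimes> s"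
  then have "s \<otimes> x \<otimes> s = s \<otimes> (s \<otimes> (y \<otimes> s \<otimes> s))"
    using assms by (auto simp: m_assoc)
  then show "s \<otimes> x \<otimes> s = y" using assms by simp
qed

lemma generator_conj_twice [simp]:
  assumes "s \<in> S" "x \<in> carrier W"
  shows "s \<otimes> (s \<otimes> x \<otimes> s) \<otimes> s = x"
  using generator_conj_eq_iff[of s x "s \<otimes> x \<otimes> s"] assms by simp

text \<open>The only relators of a right-angled system are \<open>s s\<close>, from \<open>m s s = 1\<close>, and \<open>s t s t\<close>, from
  \<open>m s t = 2\<close>; the latter makes \<open>s\<close> and \<open>t\<close> commute.\<close>

lemma coxeter_relator_cases:
  assumes "r \<in> coxeter_relators S m"
  obtains (square) s where "s \<in> S" "map fst r = [s, s]"
  | (commute) s t where "s \<in> S" "t \<in> S" "s \<noteq> t" "map fst r = [s, t, s, t]" "s \<otimes> t = t \<otimes> s"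
proof -
  from assms obtain s t k where r: "r = concat (replicate k [(s, True), (t, True)])"
    and st: "s \<in> S" "t \<in> S" and k: "m s t = enat k"
    by (auto simp: coxeter_relators_def)
  show thesis
  proof (cases "s = t")
    case True
    then have "m s t = 1" using coxeter_matrix st by (simp add: coxeter_matrix_def)
    then have "k = 1" using k by (simp add: one_enat_def)
    then show thesis using square[of s] r st True by simp
  next
    case False
    then have "m s t \<ge> 2" using coxeter_matrix st by (simp add: coxeter_matrix_def)
    then have "k = 2" using right_angled[OF st] k
      by (auto simp: one_enat_def numeral_eq_enat)
    then have r2: "r = [(s, True), (t, True), (s, True), (t, True)]"
      using r by (simp add: numeral_2_eq_2)
    have "s \<otimes> (t \<otimes> (s \<otimes> t)) = \<one>"
      using relator_trivial[OF assms] r2 st by (simp add: eval_signed_def)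
    then have "s \<otimes> (s \<otimes> (t \<otimes> (s \<otimes> t))) = s" using st by simp
    then have "t \<otimes> (s \<otimes> t) = s" using st by simp
    then have "t \<otimes> (t \<otimes> (s \<otimes> t)) = t \<otimes> s" by simp
    then have "s \<otimes> t = t \<otimes> s" using st by simp
    then show thesis using commute[of s t] r2 st False by simp
  qed
qed

lemma eval_word_closed [simp]: "ws \<in> lists S \<Longrightarrow> eval_word W ws \<in> carrier W"
  by (induction ws) auto

lemma eval_word_append:
  "us \<in> lists S \<Longrightarrow> vs \<in> lists S \<Longrightarrow> eval_word W (us @ vs) = eval_word W us \<otimes> eval_word W vs"
  by (induction us) (auto simp: m_assoc)

lemma ex_word:
  assumes "w \<in> carrier W"
  shows "\<exists>ws\<in>lists S. eval_word W ws = w"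
proof -
  have "w \<in> generate W S" using assms generate_S by simp
  then show ?thesis
  proof (induction rule: generate.induct)
    case one
    show ?case by (intro bexI[of _ "[]"]) auto
  next
    case (incl s)
    then show ?case by (intro bexI[of _ "[s]"]) auto
  next
    case (inv s)
    then have "inv s = s" by (intro inv_equality) auto
    with inv show ?case by (intro bexI[of _ "[s]"]) auto
  next
    case (eng g h)
    then obtain us vs where "us \<in> lists S" "eval_word W us = g" "vs \<in> lists S" "eval_word W vs = h"
      by blast
    then show ?case by (intro bexI[of _ "us @ vs"]) (auto simp: eval_word_append)
  qed
qed

lemma word_length_le: "ws \<in> lists S \<Longrightarrow> word_length W S (eval_word W ws) \<le> length ws"
  unfolding word_length_def by (rule Least_le) blast

lemma ex_reduced_word:
  assumes "w \<in> carrier W"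
  shows "\<exists>ws. reduced_word_for W S ws w"
proof -
  have "\<exists>n. \<exists>ws \<in> lists S. eval_word W ws = w \<and> length ws = n"
    using ex_word[OF assms] by blast
  from LeastI_ex[OF this] show ?thesis
    unfolding reduced_word_for_def word_length_def by blast
qed

lemma reduced_append_left:
  assumes "reduced_word_for W S (us @ vs) w"
  shows "reduced_word_for W S us (eval_word W us)"
proof -
  have mem: "us \<in> lists S" "vs \<in> lists S" and w: "eval_word W (us @ vs) = w"
    and len: "length (us @ vs) = word_length W S w"
    using assms by (auto simp: reduced_word_for_def)
  obtain us' where us': "reduced_word_for W S us' (eval_word W us)"
    using ex_reduced_word[OF eval_word_closed[OF mem(1)]] by blast
  then have "us' \<in> lists S" "eval_word W us' = eval_word W us"
    by (auto simp: reduced_word_for_def)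
  then have "eval_word W (us' @ vs) = w" "us' @ vs \<in> lists S"
    using w mem by (auto simp: eval_word_append)
  then have "word_length W S w \<le> length (us' @ vs)" using word_length_le by blast
  then have "length us \<le> word_length W S (eval_word W us)"
    using len us' by (simp add: reduced_word_for_def)
  then show ?thesis
    using mem word_length_le[OF mem(1)] by (simp add: reduced_word_for_def)
qed

lemma reduced_replace_prefix:
  assumes "reduced_word_for W S (us @ vs) w" "reduced_word_for W S us' (eval_word W us)"
  shows "reduced_word_for W S (us' @ vs) w"
proof -
  have "us \<in> lists S" "vs \<in> lists S" "us' \<in> lists S"
    using assms by (auto simp: reduced_word_for_def)
  moreover have "length us' = length us" "eval_word W us' = eval_word W us"
    using assms(2) reduced_append_left[OF assms(1)] by (simp_all add: reduced_word_for_def)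
  ultimately show ?thesis
    using assms(1) by (simp add: reduced_word_for_def eval_word_append)
qed

lemma reduced_tl:
  assumes "reduced_word_for W S (s # ws) w"
  shows "reduced_word_for W S ws (eval_word W ws)"
proof -
  have mem: "s \<in> S" "ws \<in> lists S" and w: "s \<otimes> eval_word W ws = w"
    and len: "Suc (length ws) = word_length W S w"
    using assms by (auto simp: reduced_word_for_def)
  obtain us where us: "reduced_word_for W S us (eval_word W ws)"
    using ex_reduced_word[OF eval_word_closed[OF mem(2)]] by blast
  then have "s # us \<in> lists S" "eval_word W (s # us) = w"
    using mem w by (auto simp: reduced_word_for_def)
  then have "word_length W S w \<le> Suc (length us)"
    using word_length_le[of "s # us"] by simp
  then show ?thesis
    using mem len us word_length_le[OF mem(2)] by (auto simp: reduced_word_for_def)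
qed

section \<open>The parity of reflections is an invariant of the group element\<close>

text \<open>A common prefix conjugates the reflections of both tails by the same element, so a change
  of the tail that preserves all parities may be made anywhere inside a word.\<close>

lemma odd_reflection_append_cong:
  assumes "us \<in> lists S" "x \<in> carrier W"
    and "\<And>y. y \<in> carrier W \<Longrightarrow> odd_reflection W vs y r = odd_reflection W vs' y r"
  shows "odd_reflection W (us @ vs) x r = odd_reflection W (us @ vs') x r"
  using assms(1,2)
  by (induction us arbitrary: x) (use assms(3) in auto)

lemma odd_reflection_square:
  assumes "s \<in> S" "x \<in> carrier W"
  shows "odd_reflection W (s # s # ws) x r = odd_reflection W ws x r"
  using assms generator_conj_eq_iff[of s x s] by auto

text \<open>As \<open>s\<close> and \<open>t\<close> commute, conjugation by either fixes both, so the four reflections of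
  \<open>s t s t\<close> are \<open>s, t, s, t\<close>, each with its own type.\<close>

lemma odd_reflection_commute:
  assumes st: "s \<in> S" "t \<in> S" "s \<otimes> t = t \<otimes> s" and x: "x \<in> carrier W"
  shows "odd_reflection W (s # t # s # t # ws) x r = odd_reflection W ws x r"
proof -
  let ?y = "s \<otimes> x \<otimes> s" let ?z = "t \<otimes> ?y \<otimes> t"
  have st_conj: "s \<otimes> t \<otimes> s = t" "t \<otimes> s \<otimes> t = s"
    using st generator_cancel(2)[of s t] generator_cancel(2)[of t s] by simp_all
  have self: "s \<otimes> s \<otimes> s = s" "t \<otimes> t \<otimes> t = t"
    using st(1,2) by simp_all
  have y: "?y = s \<longleftrightarrow> x = s" "?y = t \<longleftrightarrow> x = t"
    using generator_conj_eq_iff[OF st(1) x, of s] generator_conj_eq_iff[OF st(1) x, of t]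
      st_conj(1) self(1) st(1,2) by (metis generator_closed)+
  have z: "?z = s \<longleftrightarrow> x = s" "?z = t \<longleftrightarrow> x = t"
    using generator_conj_eq_iff[of t ?y s] generator_conj_eq_iff[of t ?y t]
      st_conj(2) self(2) y st(1,2) x by (metis generator_closed m_closed)+
  have "s \<otimes> ?z \<otimes> s = (s \<otimes> t) \<otimes> ?y \<otimes> (t \<otimes> s)"
    using st(1,2) x by (simp add: m_assoc)
  also have "\<dots> = (t \<otimes> s) \<otimes> ?y \<otimes> (s \<otimes> t)"
    using st(3) by simp
  also have "\<dots> = t \<otimes> (s \<otimes> ?y \<otimes> s) \<otimes> t"
    using st(1,2) x by (simp add: m_assoc)
  also have "\<dots> = t \<otimes> x \<otimes> t"
    using st(1) x by simp
  finally have sz: "s \<otimes> ?z \<otimes> s = t \<otimes> x \<otimes> t" .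
  have "t \<otimes> x \<otimes> t = t \<longleftrightarrow> x = t"
    using generator_conj_eq_iff[OF st(2) x, of t] self(2) st(2) by (metis generator_closed)
  then show ?thesis
    using st(1,2) x y z by (simp add: sz) auto
qed

lemma odd_reflection_pres_eq:
  assumes "pres_eq S (coxeter_relators S m) u v" "x \<in> carrier W"
  shows "odd_reflection W (map fst u) x r = odd_reflection W (map fst v) x r"
  using assms
proof (induction arbitrary: x rule: pres_eq.induct)
  case (cancel u v s b)
  have "odd_reflection W (map fst u @ (s # s # map fst v)) x r
      = odd_reflection W (map fst u @ map fst v) x r"
    using cancel by (intro odd_reflection_append_cong odd_reflection_square) force+
  then show ?case by simp
next
  case (relator u v w)
  have "odd_reflection W (map fst u @ (map fst w @ map fst v)) x r
      = odd_reflection W (map fst u @ map fst v) x r"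
  proof (rule odd_reflection_append_cong)
    fix y assume y: "y \<in> carrier W"
    from relator(3) show "odd_reflection W (map fst w @ map fst v) y r
        = odd_reflection W (map fst v) y r"
    proof (cases rule: coxeter_relator_cases)
      case (square s)
      then show ?thesis using odd_reflection_square[of s y] y by simp
    next
      case (commute s t)
      then show ?thesis using odd_reflection_commute[of s t y] y by simp
    qed
  qed (use relator in force)+
  then show ?case by simp
qed auto

lemma odd_reflection_eval_eq:
  assumes "us \<in> lists S" "vs \<in> lists S" "eval_word W us = eval_word W vs" "x \<in> carrier W"
  shows "odd_reflection W us x r = odd_reflection W vs x r"
proof -
  let ?pos = "map (\<lambda>s. (s, True))"
  have "pres_eq S (coxeter_relators S m) (?pos us) (?pos vs)"
    using assms by (subst eval_eq_iff_pres_eq[symmetric]) (auto simp: eval_signed_positive)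
  from odd_reflection_pres_eq[OF this assms(4), of r] show ?thesis
    by (simp add: comp_def)
qed

section \<open>Letter counts of reduced words\<close>

text \<open>Multiplying by the reflection \<open>t\<^sub>i = s\<^sub>1 \<dots> s\<^sub>i \<dots> s\<^sub>1\<close> on the left deletes the letter \<open>s\<^sub>i\<close>.\<close>

lemma odd_reflection_shortens:
  assumes "ws \<in> lists S" "x \<in> carrier W" "odd_reflection W ws x r"
  shows "\<exists>us\<in>lists S. length us < length ws \<and> eval_word W us = x \<otimes> eval_word W ws"
  using assms
proof (induction ws arbitrary: x rule: list.induct)
  case (Cons s ws)
  have s: "s \<in> S" and ws: "ws \<in> lists S" and x: "x \<in> carrier W"
    using Cons.prems by auto
  show ?case
  proof (cases "x = s")
    case True
    then show ?thesis using s ws by (intro bexI[of _ ws]) auto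
  next
    case False
    then have "odd_reflection W ws (s \<otimes> x \<otimes> s) r" using Cons.prems by simp
    then obtain us where us: "us \<in> lists S" "length us < length ws"
      "eval_word W us = s \<otimes> x \<otimes> s \<otimes> eval_word W ws"
      using Cons.IH[OF ws, of "s \<otimes> x \<otimes> s"] x s by auto
    then have "eval_word W (s # us) = x \<otimes> eval_word W (s # ws)"
      using s ws x by (simp add: m_assoc)
    then show ?thesis using us s by (intro bexI[of _ "s # us"]) auto
  qed
qed simp

text \<open>Reducedness makes the reflections of the word distinct, so that nothing cancels modulo 2 and
  every letter \<open>r\<close> is seen by its own reflection.\<close>

lemma card_odd_reflections_reduced:
  assumes "reduced_word_for W S ws w"
  shows "finite {x \<in> carrier W. odd_reflection W ws x r}
    \<and> card {x \<in> carrier W. odd_reflection W ws x r} = count_list ws r"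
  using assms
proof (induction ws arbitrary: w)
  case (Cons s ws)
  let ?A = "{x \<in> carrier W. odd_reflection W ws x r}"
  let ?B = "{x \<in> carrier W. odd_reflection W (s # ws) x r}"
  let ?c = "\<lambda>x. s \<otimes> x \<otimes> s"
  have s: "s \<in> S" and ws: "ws \<in> lists S" and w: "s \<otimes> eval_word W ws = w"
    and len: "Suc (length ws) = word_length W S w"
    using Cons.prems by (auto simp: reduced_word_for_def)
  have A: "finite ?A" "card ?A = count_list ws r"
    using Cons.IH[OF reduced_tl[OF Cons.prems]] by auto
  have inj: "inj_on ?c ?A"
    by (rule inj_on_inverseI[where g = ?c]) (use s in auto)
  have image: "?c ` ?A = {x \<in> carrier W. odd_reflection W ws (?c x) r}"
  proof (intro equalityI subsetI)
    fix x assume "x \<in> {x \<in> carrier W. odd_reflection W ws (?c x) r}"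
    then show "x \<in> ?c ` ?A" using s by (intro image_eqI[of _ _ "?c x"]) auto
  qed (use s in auto)
  \<comment> \<open>Here \<open>s s s = s\<close>: if the reflection \<open>s\<close> occurred for the tail too, multiplying by \<open>s\<close> would
    shorten the tail instead of lengthening it.\<close>
  have not_s: "\<not> odd_reflection W ws (?c s) r"
  proof
    assume "odd_reflection W ws (?c s) r"
    then obtain us where "us \<in> lists S" "length us < length ws" "eval_word W us = w"
      using odd_reflection_shortens[of ws s r] s ws w by auto
    then show False using word_length_le[of us] len by simp
  qed
  show ?case
  proof (cases "r = s")
    case True
    have B: "?B = insert s (?c ` ?A)"
      unfolding image using True not_s s by auto
    have "s \<notin> ?c ` ?A" unfolding image using not_s by auto
    then show ?thesis unfolding B using A inj True by (simp add: card_image)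
  next
    case False
    have B: "?B = ?c ` ?A" unfolding image using False by auto
    show ?thesis unfolding B using A inj False by (simp add: card_image)
  qed
qed simp

lemma reduced_words_same_count:
  assumes "reduced_word_for W S us w" "reduced_word_for W S vs w"
  shows "count_list us r = count_list vs r"
proof -
  have "{x \<in> carrier W. odd_reflection W us x r} = {x \<in> carrier W. odd_reflection W vs x r}"
    using odd_reflection_eval_eq[of us vs] assms by (auto simp: reduced_word_for_def)
  then show ?thesis
    using card_odd_reflections_reduced[OF assms(1), of r]
      card_odd_reflections_reduced[OF assms(2), of r] by simp
qed

section \<open>Long elements have long firm prefixes\<close>

lemma ex_firm_prefix:
  assumes "reduced_word_for W S ws w" "s \<in> S" "count_list ws s > n"
  shows "\<exists>ss ts. reduced_word_for W S (ss @ ts) w \<and> n < length ss \<and> firm W S (eval_word W ss)"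
proof -
  define good where
    "good = (\<lambda>ss. (\<exists>ts. reduced_word_for W S (ss @ ts) w) \<and> count_list ss s > n)"
  have "good ws" using assms by (auto simp: good_def intro: exI[of _ "[]"])
  from ex_has_least_nat[of good, OF this, of length]
  obtain ss where ss: "good ss" and least: "\<And>us. good us \<Longrightarrow> length ss \<le> length us" by blast
  then obtain ts where ts: "reduced_word_for W S (ss @ ts) w" and count: "count_list ss s > n"
    by (auto simp: good_def)
  have ends_in_s: "us \<noteq> [] \<and> last us = s" if us: "reduced_word_for W S us (eval_word W ss)" for us
  proof -
    have count_us: "count_list us s > n"
      using reduced_words_same_count[OF us reduced_append_left[OF ts]] count by simp
    then have "us \<noteq> []" by auto
    then obtain vs a where vs: "us = vs @ [a]" by (metis rev_exhaust)
    \<comment> \<open>Otherwise \<open>a\<close> can be moved into the rest of the word of \<open>w\<close> without losing any \<open>s\<close>, against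
      the minimality of \<open>ss\<close>.\<close>
    have "a = s"
    proof (rule ccontr)
      assume "a \<noteq> s"
      then have "count_list vs s > n" using count_us vs by simp
      moreover have "reduced_word_for W S (vs @ ([a] @ ts)) w"
        using reduced_replace_prefix[OF ts us] vs by simp
      ultimately have "good vs" unfolding good_def by blast
      from least[OF this] have "length ss \<le> length vs" .
      moreover have "length us = length ss"
        using us reduced_append_left[OF ts] by (simp add: reduced_word_for_def)
      ultimately show False using vs by simp
    qed
    then show ?thesis using vs by simp
  qed
  then have "firm W S (eval_word W ss)" using \<open>s \<in> S\<close> by (auto simp: firm_def)
  moreover have "n < length ss" using count count_le_length[of ss s] by linarith
  ultimately show ?thesis using ts by blast
qed

lemma firmness_ge:
  assumes "reduced_word_for W S (ss @ ts) w" "firm W S (eval_word W ss)" "ss \<noteq> []"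
  shows "firmness W S w \<ge> length ss"
proof -
  let ?K = "{k. \<exists>ss ts. reduced_word_for W S (ss @ ts) w \<and> length ss = k \<and> firm W S (eval_word W ss)}"
  have "w \<noteq> \<one>"
    using assms(1,3) word_length_le[of "[]"] by (auto simp: reduced_word_for_def)
  moreover have "?K \<subseteq> {..word_length W S w}"
    by (auto simp: reduced_word_for_def)
  then have "finite ?K" using finite_subset by blast
  then have "length ss \<le> Max ?K" using assms by (intro Max_ge) auto
  ultimately show ?thesis by (simp add: firmness_def)
qed

text \<open>Were every generator to occur at most \<open>n\<close> times in a reduced word, its length would be at
  most \<open>n \<cdot> |S|\<close>.\<close>

lemma firmness_gt:
  assumes "w \<in> carrier W" "word_length W S w > n * card S"
  shows "firmness W S w > n"
proof -
  obtain ws where ws: "reduced_word_for W S ws w" using ex_reduced_word assms(1) by blast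
  have "\<exists>s\<in>S. count_list ws s > n"
  proof (rule ccontr)
    assume "\<not> ?thesis"
    then have "sum (count_list ws) S \<le> (\<Sum>s\<in>S. n)" by (intro sum_mono) (auto simp: not_less)
    moreover have "sum (count_list ws) S = length ws"
      using ws finite_generators by (intro sum_count_set) (auto simp: reduced_word_for_def)
    ultimately show False
      using ws assms(2) by (simp add: reduced_word_for_def mult.commute)
  qed
  then obtain ss ts where ss: "reduced_word_for W S (ss @ ts) w" "n < length ss"
      "firm W S (eval_word W ss)"
    using ex_firm_prefix[OF ws] by blast
  have "ss \<noteq> []" using ss(2) by auto
  from firmness_ge[OF ss(1,3) this] ss(2) show ?thesis by simp
qed

end

theorem theorem2p18:
  fixes W :: "('a, 'b) monoid_scheme" and S :: "'a set" and m :: "'a \<Rightarrow> 'a \<Rightarrow> enat"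
  assumes "right_angled_coxeter_system W S m"
  shows "\<forall>n::nat. \<exists>d::nat. \<forall>w \<in> carrier W. word_length W S w > d \<longrightarrow> firmness W S w > n"
  using right_angled_coxeter_system.firmness_gt[OF assms] by blast

end
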